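(* Let $G$ be an lcsc group, $H$ a closed unimodular subgroup, $\Gamma$ a discrete lattice in $G$ acting ergodically on $X=G/H$, and suppose Assumptions 1–4 below hold. Then for every $x\in X$ whose $\Gamma$-orbit is dense and for $m_X$-almost every $x_0\in X$, $\kappa_\Gamma(x,x_0)\ge d'/a$.
   Context: Setting: $m_G$, $m_H$ Haar measures; $m_X$ the $G$-invariant measure on $X=G/H$ with $\int_G f\,dm_G=\int_X\int_H f(gh)\,dm_H(h)\,dm_X(gH)$. $\mathrm{dist}$ is a metric on $X$, $\mathcal O_\epsilon(x_0)=\{x:\mathrm{dist}(x,x_0)<\epsilon\}$. $D:G\to\mathbb R_+$ is proper continuous, $|g|_D=e^{D(g)}$, $G_t=\{g:D(g)\le t\}$, $H_t=G_t\cap H$. For $x,x_0\in X$, $\kappa_\Gamma(x,x_0)$ is the infimum of $\zeta>0$ for which there exists $\epsilon_0>0$ such that for every $\epsilon\in(0,\epsilon_0)$ some $\gamma\in\Gamma$ satisfies $\mathrm{dist}(\gamma^{-1}x,x_0)\le\epsilon$ and $|\gamma|_D\le\epsilon^{-\zeta}$. Assumption 1: for all compact $\Omega\subset G$, $S\subset X$ there is $C_0$ with $\mathrm{dist}(gx,gx_0)\le C_0\,\mathrm{dist}(x,x_0)$ for $g\in\Omega$, $x,x_0\in S$. Assumption 2: for every compact $\Omega\subset G$ there is $b(\Omega)$ with $D(ugv)\le D(g)+b(\Omega)$ for all $u,v\in\Omega$, $g\in G$. Assumption 3: there are $0<a'\le a<\infty$ such that for every $\eta>0$ there exist $C_2(\eta)\ge1$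 and $t_\eta$ with $C_2^{-1}e^{t(a'-\eta)}\le m_H(H_t)\le C_2e^{t(a+\eta)}$ for $t\ge t_\eta$; the same holds with $H$ replaced by any conjugate $gHg^{-1}$ (and $H_t$ by $G_t\cap gHg^{-1}$), with the same $a,a'$ and constants uniform as $g$ ranges over compact sets. Assumption 4: there are $0<d'\le d<\infty$ such that for every $x_0\in X$ and $\eta>0$ there exist $C_3(x_0,\eta)\ge1$, $\epsilon_0(x_0,\eta)>0$ with $C_3^{-1}\epsilon^{d+\eta}\le m_X(\mathcal O_\epsilon(x_0))\le C_3\epsilon^{d'-\eta}$ for $\epsilon\in(0,\epsilon_0)$, the constants being uniform as $x_0$ ranges over compact sets. *)

theory Defs
  imports "HOL-Analysis.Analysis" "HOL-Algebra.Left_Coset"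
begin

locale topological_group = group G for G (structure) +
  fixes T :: "'a topology"
  assumes topspace_eq_carrier: "topspace T = carrier G"
    and continuous_mult: "continuous_map (prod_topology T T) T (\<lambda>(x, y). x \<otimes> y)"
    and continuous_inv: "continuous_map T T (\<lambda>x. inv x)"

locale lcsc_group = topological_group +
  assumes locally_compact: "locally_compact_space T"
    and Hausdorff: "Hausdorff_space T"
    and second_countable: "second_countable T"

text \<open>The set of left cosets of \<open>K\<close> is \<open>lcosets\<^bsub>G\<^esub> K\<close>, and \<open>g <#\<^bsub>G\<^esub> x\<close> is the
  translate of the coset \<open>x\<close> by \<open>g\<close>. A set of cosets is open in the quotient topology iff the
  union of its members, i.e. its preimage under the projection, is open.\<close>

definition coset_topology :: "('a, 'm) monoid_scheme \<Rightarrow> 'a topology \<Rightarrow> 'a set \<Rightarrow> 'a set topology" where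
  "coset_topology G T K = topology (\<lambda>U. U \<subseteq> lcosets\<^bsub>G\<^esub> K \<and> openin T (\<Union>U))"

lemma (in group) lcoset_Union_Int:
  assumes K: "subgroup K G" and "U \<subseteq> lcosets K" "V \<subseteq> lcosets K"
  shows "\<Union>(U \<inter> V) = \<Union>U \<inter> \<Union>V"
proof -
  have "x = y" if "x \<in> U" "y \<in> V" "p \<in> x" "p \<in> y" for x y p
    using assms(2,3) that lcos_disjoint[OF K, of x y] by blast
  then show ?thesis by blast
qed

lemma (in topological_group) openin_coset_topology:
  assumes K: "subgroup K G"
  shows "openin (coset_topology G T K) U \<longleftrightarrow> U \<subseteq> lcosets K \<and> openin T (\<Union>U)"
proof -
  have "istopology (\<lambda>U. U \<subseteq> lcosets K \<and> openin T (\<Union>U))"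
    unfolding istopology_def
  proof (intro conjI allI impI)
    fix \<U> assume *: "\<forall>U\<in>\<U>. U \<subseteq> lcosets K \<and> openin T (\<Union>U)"
    then show "\<Union>\<U> \<subseteq> lcosets K" by blast
    have "\<Union>(\<Union>\<U>) = \<Union>(Union ` \<U>)" by blast
    then show "openin T (\<Union>(\<Union>\<U>))" 
      using * openin_Union[of "Union ` \<U>" T] by auto
  qed (auto simp: lcoset_Union_Int[OF K])
  then show ?thesis
    by (simp add: coset_topology_def)
qed

definition borel_on :: "'a topology \<Rightarrow> 'a measure" where
  "borel_on T = sigma (topspace T) {U. openin T U}"

text \<open>Regularity is automatic here, since all groups considered are locally compact and second
  countable.\<close>

definition haar_measure :: "('a, 'm) monoid_scheme \<Rightarrow> 'a topology \<Rightarrow> 'a measure \<Rightarrow> bool" where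
  "haar_measure G T \<mu> \<longleftrightarrow>
     sets \<mu> = sets (borel_on T) \<and>
     (\<forall>K. compactin T K \<longrightarrow> emeasure \<mu> K < \<infinity>) \<and>
     (\<forall>U. openin T U \<longrightarrow> U \<noteq> {} \<longrightarrow> emeasure \<mu> U > 0) \<and>
     (\<forall>g\<in>carrier G. \<forall>A\<in>sets \<mu>. emeasure \<mu> (g <#\<^bsub>G\<^esub> A) = emeasure \<mu> A)"

definition unimodular :: "('a, 'm) monoid_scheme \<Rightarrow> 'a topology \<Rightarrow> bool" where
  "unimodular G T \<longleftrightarrow>
     (\<forall>\<mu>. haar_measure G T \<mu> \<longrightarrow>
        (\<forall>g\<in>carrier G. \<forall>A\<in>sets \<mu>. emeasure \<mu> (A #>\<^bsub>G\<^esub> g) = emeasure \<mu> A))"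

definition translation_invariant :: "('a, 'm) monoid_scheme \<Rightarrow> 'a set measure \<Rightarrow> bool" where
  "translation_invariant G \<nu> \<longleftrightarrow>
     (\<forall>g\<in>carrier G. \<forall>A\<in>sets \<nu>. emeasure \<nu> ((\<lambda>x. g <#\<^bsub>G\<^esub> x) ` A) = emeasure \<nu> A)"

definition lattice_in :: "('a, 'm) monoid_scheme \<Rightarrow> 'a topology \<Rightarrow> 'a set \<Rightarrow> bool" where
  "lattice_in G T \<Gamma> \<longleftrightarrow>
     subgroup \<Gamma> G \<and> subtopology T \<Gamma> = discrete_topology \<Gamma> \<and>
     (\<exists>\<nu>. sets \<nu> = sets (borel_on (coset_topology G T \<Gamma>)) \<and> translation_invariant G \<nu> \<and>
          0 < emeasure \<nu> (space \<nu>) \<and> emeasure \<nu> (space \<nu>) < \<infinity>)"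

definition ergodic_action :: "('a, 'm) monoid_scheme \<Rightarrow> 'a set \<Rightarrow> 'a set measure \<Rightarrow> bool" where
  "ergodic_action G \<Gamma> \<nu> \<longleftrightarrow>
     (\<forall>A\<in>sets \<nu>. (\<forall>\<gamma>\<in>\<Gamma>. (\<lambda>x. \<gamma> <#\<^bsub>G\<^esub> x) ` A = A) \<longrightarrow>
        emeasure \<nu> A = 0 \<or> emeasure \<nu> (space \<nu> - A) = 0)"

text \<open>The inner integral does not depend on the representative of the coset \<open>x\<close> because
  \<open>m\<^sub>H\<close> is left invariant; \<open>SOME g. g \<in> x\<close> merely picks one.\<close>

definition weil_formula ::
    "('a, 'm) monoid_scheme \<Rightarrow> 'a measure \<Rightarrow> 'a measure \<Rightarrow> 'a set measure \<Rightarrow> bool" where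
  "weil_formula G m\<^sub>G m\<^sub>H m\<^sub>X \<longleftrightarrow>
     (\<forall>f \<in> borel_measurable m\<^sub>G.
        (\<integral>\<^sup>+ g. f g \<partial>m\<^sub>G) = (\<integral>\<^sup>+ x. (\<integral>\<^sup>+ h. f ((SOME g. g \<in> x) \<otimes>\<^bsub>G\<^esub> h) \<partial>m\<^sub>H) \<partial>m\<^sub>X))"

definition gauge_ball :: "('a, 'm) monoid_scheme \<Rightarrow> ('a \<Rightarrow> real) \<Rightarrow> real \<Rightarrow> 'a set" where
  "gauge_ball G D t = {g \<in> carrier G. D g \<le> t}"

text \<open>Extended-real valued, so that the infimum of the empty set is \<open>\<infinity>\<close>.\<close>

definition approx_exponent ::
    "('a, 'm) monoid_scheme \<Rightarrow> ('a \<Rightarrow> real) \<Rightarrow> ('a set \<Rightarrow> 'a set \<Rightarrow> real) \<Rightarrow> 'a set \<Rightarrow>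
     'a set \<Rightarrow> 'a set \<Rightarrow> ereal" where
  "approx_exponent G D d \<Gamma> x x\<^sub>0 =
     Inf {ereal \<zeta> |\<zeta>. \<zeta> > 0 \<and>
       (\<exists>\<epsilon>\<^sub>0>0. \<forall>\<epsilon>. 0 < \<epsilon> \<and> \<epsilon> < \<epsilon>\<^sub>0 \<longrightarrow>
          (\<exists>\<gamma>\<in>\<Gamma>. d (inv\<^bsub>G\<^esub> \<gamma> <#\<^bsub>G\<^esub> x) x\<^sub>0 \<le> \<epsilon> \<and> exp (D \<gamma>) \<le> \<epsilon> powr (- \<zeta>)))}"

definition assumption1 ::
    "('a, 'm) monoid_scheme \<Rightarrow> 'a topology \<Rightarrow> 'a set \<Rightarrow> ('a set \<Rightarrow> 'a set \<Rightarrow> real) \<Rightarrow> bool" where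
  "assumption1 G T H d \<longleftrightarrow>
     (\<forall>\<Omega> S. compactin T \<Omega> \<and> compactin (coset_topology G T H) S \<longrightarrow>
        (\<exists>C\<^sub>0. \<forall>g\<in>\<Omega>. \<forall>x\<in>S. \<forall>x\<^sub>0\<in>S. d (g <#\<^bsub>G\<^esub> x) (g <#\<^bsub>G\<^esub> x\<^sub>0) \<le> C\<^sub>0 * d x x\<^sub>0))"

definition assumption2 ::
    "('a, 'm) monoid_scheme \<Rightarrow> 'a topology \<Rightarrow> ('a \<Rightarrow> real) \<Rightarrow> bool" where
  "assumption2 G T D \<longleftrightarrow>
     (\<forall>\<Omega>. compactin T \<Omega> \<longrightarrow>
        (\<exists>b. \<forall>u\<in>\<Omega>. \<forall>v\<in>\<Omega>. \<forall>g\<in>carrier G. D (u \<otimes>\<^bsub>G\<^esub> g \<otimes>\<^bsub>G\<^esub> v) \<le> D g + b))"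

definition conjugate_set :: "('a, 'm) monoid_scheme \<Rightarrow> 'a \<Rightarrow> 'a set \<Rightarrow> 'a set" where
  "conjugate_set G g H = (\<lambda>h. g \<otimes>\<^bsub>G\<^esub> h \<otimes>\<^bsub>G\<^esub> inv\<^bsub>G\<^esub> g) ` H"

text \<open>The Haar measure on the conjugate \<open>g H g\<inverse>\<close> is normalised by transporting \<open>m\<^sub>H\<close>
  along \<open>h \<mapsto> g h g\<inverse>\<close>.\<close>

definition conjugate_measure ::
    "('a, 'm) monoid_scheme \<Rightarrow> 'a topology \<Rightarrow> 'a set \<Rightarrow> 'a measure \<Rightarrow> 'a \<Rightarrow> 'a measure" where
  "conjugate_measure G T H m\<^sub>H g =
     distr m\<^sub>H (borel_on (subtopology T (conjugate_set G g H))) (\<lambda>h. g \<otimes>\<^bsub>G\<^esub> h \<otimes>\<^bsub>G\<^esub> inv\<^bsub>G\<^esub> g)"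

text \<open>The first conjunct concerns \<open>H\<close> itself, the second its conjugates, with \<open>C\<^sub>2\<close> and the
  threshold \<open>t\<^sub>\<eta>\<close> uniform over compact sets of conjugating elements.\<close>

definition assumption3 ::
    "('a, 'm) monoid_scheme \<Rightarrow> 'a topology \<Rightarrow> 'a set \<Rightarrow> 'a measure \<Rightarrow> ('a \<Rightarrow> real) \<Rightarrow>
     real \<Rightarrow> real \<Rightarrow> bool" where
  "assumption3 G T H m\<^sub>H D a' a \<longleftrightarrow>
     0 < a' \<and> a' \<le> a \<and>
     (\<forall>\<eta>>0. \<exists>C\<^sub>2\<ge>1. \<exists>t\<^sub>\<eta>. \<forall>t\<ge>t\<^sub>\<eta>.
        ennreal (exp (t * (a' - \<eta>)) / C\<^sub>2) \<le> emeasure m\<^sub>H (gauge_ball G D t \<inter> H) \<and>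
        emeasure m\<^sub>H (gauge_ball G D t \<inter> H) \<le> ennreal (C\<^sub>2 * exp (t * (a + \<eta>)))) \<and>
     (\<forall>\<Omega>. compactin T \<Omega> \<longrightarrow> (\<forall>\<eta>>0. \<exists>C\<^sub>2\<ge>1. \<exists>t\<^sub>\<eta>. \<forall>g\<in>\<Omega>. \<forall>t\<ge>t\<^sub>\<eta>.
        ennreal (exp (t * (a' - \<eta>)) / C\<^sub>2)
          \<le> emeasure (conjugate_measure G T H m\<^sub>H g) (gauge_ball G D t \<inter> conjugate_set G g H) \<and>
        emeasure (conjugate_measure G T H m\<^sub>H g) (gauge_ball G D t \<inter> conjugate_set G g H)
          \<le> ennreal (C\<^sub>2 * exp (t * (a + \<eta>)))))"

text \<open>Uniformity over compact sets contains the pointwise statement (take \<open>S\<close> a singleton).\<close>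

definition assumption4 ::
    "('a, 'm) monoid_scheme \<Rightarrow> 'a topology \<Rightarrow> 'a set \<Rightarrow> 'a set measure \<Rightarrow>
     ('a set \<Rightarrow> 'a set \<Rightarrow> real) \<Rightarrow> real \<Rightarrow> real \<Rightarrow> bool" where
  "assumption4 G T H m\<^sub>X d \<delta>' \<delta> \<longleftrightarrow>
     0 < \<delta>' \<and> \<delta>' \<le> \<delta> \<and>
     (\<forall>S. compactin (coset_topology G T H) S \<longrightarrow> (\<forall>\<eta>>0. \<exists>C\<^sub>3\<ge>1. \<exists>\<epsilon>\<^sub>0>0.
        \<forall>x\<^sub>0\<in>S. \<forall>\<epsilon>. 0 < \<epsilon> \<and> \<epsilon> < \<epsilon>\<^sub>0 \<longrightarrow>
          ennreal (\<epsilon> powr (\<delta> + \<eta>) / C\<^sub>3)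
            \<le> emeasure m\<^sub>X (Metric_space.mball (lcosets\<^bsub>G\<^esub> H) d x\<^sub>0 \<epsilon>) \<and>
          emeasure m\<^sub>X (Metric_space.mball (lcosets\<^bsub>G\<^esub> H) d x\<^sub>0 \<epsilon>)
            \<le> ennreal (C\<^sub>3 * \<epsilon> powr (\<delta>' - \<eta>))))"

end

theory Submission
  imports Defs
begin

text \<open>
  Write \<open>x = gH\<close> and let \<open>K\<close> be a gauge ball. If \<open>\<gamma>\<inverse>x \<in> KH\<close>, then
  \<open>h = g\<inverse>\<gamma>k \<in> H\<close> for some \<open>k \<in> K\<close>, and \<open>D h \<le> D \<gamma> + O(1)\<close>. Cover \<open>K\<close> by finitely many
  open \<open>A\<close> with neighbourhoods \<open>V\<close> of the identity such that \<open>AV(AV)\<inverse>\<close> meets \<open>\<Gamma>\<close> only in the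
  identity. For different \<open>\<gamma>\<close> with \<open>k\<close> in the same \<open>A\<close> the left translates \<open>h(V \<inter> H)\<close> are
  disjoint, so the number of \<open>\<gamma>\<close> with \<open>D \<gamma> \<le> t\<close> and \<open>\<gamma>\<inverse>x \<in> KH\<close> is \<open>O(m\<^sub>H(H\<^bsub>t+b\<^esub>))\<close>, hence
  \<open>O(e\<^bsup>(a+\<eta>)t\<^esup>)\<close>. Points \<open>x\<^sub>0\<close> in the image of \<open>K\<close> approximable with exponent \<open>q\<close> at the scale
  \<open>\<epsilon> = e\<^bsup>-t/q\<^esup>\<close> are thus covered by balls of radius \<open>2\<epsilon>\<close> of total measure
  \<open>O(\<epsilon>\<^bsup>d'-\<eta>-q(a+\<eta>)\<^esup>)\<close>, which tends to zero when \<open>q < d'/a\<close>; being approximable at all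
  small scales is therefore a null event.
\<close>

section \<open>Translates, neighbourhoods and the coset projection in a topological group\<close>

lemma openin_prod_topologyE:
  assumes "openin (prod_topology S T) W" "(x, y) \<in> W"
  obtains U V where "openin S U" "openin T V" "x \<in> U" "y \<in> V" "U \<times> V \<subseteq> W"
  using assms openin_prod_topology_alt[of S T W] by meson

context topological_group
begin

lemma openin_subset_carrier: "openin T U \<Longrightarrow> U \<subseteq> carrier G"
  using openin_subset topspace_eq_carrier by blast

lemma continuous_map_mult_left:
  assumes "g \<in> carrier G"
  shows "continuous_map T T (\<lambda>x. g \<otimes> x)"
proof -
  have "continuous_map T (prod_topology T T) (\<lambda>x. (g, x))"
    by (intro continuous_map_pairedI) (auto simp: assms topspace_eq_carrier)
  from continuous_map_compose[OF this continuous_mult] show ?thesis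
    by (simp add: o_def)
qed

lemma continuous_map_mult_right:
  assumes "g \<in> carrier G"
  shows "continuous_map T T (\<lambda>x. x \<otimes> g)"
proof -
  have "continuous_map T (prod_topology T T) (\<lambda>x. (x, g))"
    by (intro continuous_map_pairedI) (auto simp: assms topspace_eq_carrier)
  from continuous_map_compose[OF this continuous_mult] show ?thesis
    by (simp add: o_def)
qed

lemma openin_r_coset:
  assumes "openin T U" "g \<in> carrier G"
  shows "openin T (U #> g)"
proof -
  have U: "U \<subseteq> carrier G"
    using assms openin_subset_carrier by blast
  have "U #> g = {x \<in> topspace T. x \<otimes> inv g \<in> U}" (is "_ = ?R")
  proof
    show "U #> g \<subseteq> ?R"
    proof
      fix x assume "x \<in> U #> g"
      then obtain u where "u \<in> U" "x = u \<otimes> g"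
        unfolding r_coset_def by blast
      then show "x \<in> ?R"
        using U assms by (auto simp: topspace_eq_carrier subset_iff m_assoc)
    qed
    show "?R \<subseteq> U #> g"
    proof
      fix x assume "x \<in> ?R"
      then have "x = (x \<otimes> inv g) \<otimes> g" and "x \<otimes> inv g \<in> U"
        using assms by (auto simp: topspace_eq_carrier m_assoc)
      then show "x \<in> U #> g" unfolding r_coset_def by blast
    qed
  qed
  then show ?thesis
    using openin_continuous_map_preimage[OF continuous_map_mult_right, of "inv g" U] assms by simp
qed

lemma openin_subgroup_l_coset:
  assumes H: "subgroup H G" and W: "openin (subtopology T H) W" and h: "h \<in> H"
  shows "openin (subtopology T H) (h <# W)"
proof -
  have HG: "H \<subseteq> carrier G" and hG: "h \<in> carrier G" "inv h \<in> carrier G" "inv h \<in> H"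
    using H h subgroup.subset subgroup.m_inv_closed by auto
  obtain V where V: "openin T V" "W = V \<inter> H"
    using W by (auto simp: openin_subtopology)
  have "h <# W = {x \<in> topspace T. inv h \<otimes> x \<in> V} \<inter> H" (is "_ = ?R")
  proof
    show "h <# W \<subseteq> ?R"
    proof
      fix x assume "x \<in> h <# W"
      then obtain w where w: "w \<in> V" "w \<in> H" "x = h \<otimes> w"
        using V unfolding l_coset_def by blast
      then have "w \<in> carrier G" "x \<in> H"
        using HG H h subgroup.m_closed by auto
      then show "x \<in> ?R"
        using w hG by (simp add: topspace_eq_carrier m_assoc[symmetric])
    qed
    show "?R \<subseteq> h <# W"
    proof
      fix x assume "x \<in> ?R"
      then have x: "x \<in> H" "x \<in> carrier G" "inv h \<otimes> x \<in> V"
        by (auto simp: topspace_eq_carrier)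
      then have "x = h \<otimes> (inv h \<otimes> x)" "inv h \<otimes> x \<in> W"
        using hG H V subgroup.m_closed by (auto simp: m_assoc[symmetric])
      then show "x \<in> h <# W" unfolding l_coset_def by blast
    qed
  qed
  then show ?thesis
    using openin_continuous_map_preimage[OF continuous_map_mult_left, of "inv h" V] hG V
    by (auto simp: openin_subtopology)
qed

text \<open>The map sending a pair \<open>(p, p')\<close> to \<open>p \<otimes> inv p'\<close> takes
  \<open>(k, k)\<close> to \<open>\<one>\<close>, so by continuity it sends a box
  \<open>B1 \<times> B2\<close> around \<open>(k, k)\<close> into \<open>N\<close>. Continuity of
  multiplication at \<open>(k, \<one>)\<close> then keeps the products of \<open>A\<close> and
  \<open>V\<close> inside \<open>B1 \<inter> B2\<close>.\<close>

lemma nbhd_mult_inv_subset: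
  assumes k: "k \<in> carrier G" and N: "openin T N" "\<one> \<in> N"
  obtains A V where "openin T A" "k \<in> A" "openin T V" "\<one> \<in> V"
    "\<forall>u\<in>A. \<forall>v\<in>A. \<forall>w\<in>V. \<forall>w'\<in>V. (u \<otimes> w) \<otimes> inv (v \<otimes> w') \<in> N"
proof -
  have "continuous_map (prod_topology T T) (prod_topology T T) (\<lambda>p. (fst p, inv (snd p)))"
    using continuous_map_compose[OF continuous_map_snd continuous_inv, of T]
    by (intro continuous_map_pairedI continuous_map_fst) (simp add: o_def)
  from continuous_map_compose[OF this continuous_mult]
  have "continuous_map (prod_topology T T) T (\<lambda>p. fst p \<otimes> inv (snd p))"
    by (simp add: o_def)
  from openin_continuous_map_preimage[OF this N(1)]
  have "openin (prod_topology T T)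
      {p \<in> topspace (prod_topology T T). fst p \<otimes> inv (snd p) \<in> N}" (is "openin _ ?P") .
  moreover have "(k, k) \<in> ?P"
    using k N by (simp add: topspace_eq_carrier)
  ultimately obtain B1 B2 where B: "openin T B1" "openin T B2" "k \<in> B1" "k \<in> B2"
      "B1 \<times> B2 \<subseteq> ?P"
    by (rule openin_prod_topologyE)
  have "openin (prod_topology T T)
      {p \<in> topspace (prod_topology T T). (\<lambda>(x, y). x \<otimes> y) p \<in> B1 \<inter> B2}" (is "openin _ ?Q")
    by (rule openin_continuous_map_preimage[OF continuous_mult]) (use B in auto)
  moreover have "(k, \<one>) \<in> ?Q"
    using k B by (simp add: topspace_eq_carrier)
  ultimately obtain A V where AV: "openin T A" "openin T V" "k \<in> A" "\<one> \<in> V" "A \<times> V \<subseteq> ?Q"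
    by (rule openin_prod_topologyE)
  have "(u \<otimes> w) \<otimes> inv (v \<otimes> w') \<in> N" if "u \<in> A" "v \<in> A" "w \<in> V" "w' \<in> V" for u v w w'
  proof -
    have "u \<otimes> w \<in> B1" "v \<otimes> w' \<in> B2"
      using that AV(5) by auto
    then show ?thesis using B(5) by auto
  qed
  then show thesis
    by (intro that[OF AV(1,3,2,4)] ballI)
qed

lemma topspace_coset_topology:
  assumes H: "subgroup H G"
  shows "topspace (coset_topology G T H) = lcosets H"
proof
  show "topspace (coset_topology G T H) \<subseteq> lcosets H"
    using openin_coset_topology[OF H] openin_topspace by blast
  have "openin T (carrier G)"
    using openin_topspace[of T] topspace_eq_carrier by simp
  then have "openin (coset_topology G T H) (lcosets H)"
    using openin_coset_topology[OF H] lcosets_part_G[OF H] by simp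
  then show "lcosets H \<subseteq> topspace (coset_topology G T H)"
    by (rule openin_subset)
qed

text \<open>Since the cosets partition the group, the preimage of a set \<open>U\<close> of cosets
  is \<open>\<Union>U\<close>, and openness in the quotient topology is openness of that
  union.\<close>

lemma continuous_map_coset_projection:
  assumes H: "subgroup H G"
  shows "continuous_map T (coset_topology G T H) (\<lambda>g. g <# H)"
proof -
  have un: "\<Union>(lcosets H) = carrier G"
    using lcosets_part_G[OF H] .
  have pre: "{x \<in> topspace T. x <# H \<in> U} = \<Union>U" if U: "U \<subseteq> lcosets H" for U
  proof -
    have "x <# H \<in> U \<longleftrightarrow> x \<in> \<Union>U" if x: "x \<in> carrier G" for x
    proof
      assume "x <# H \<in> U"
      then show "x \<in> \<Union>U" using lcos_self[OF x H] by (rule UnionI)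
    next
      assume "x \<in> \<Union>U"
      then obtain c where c: "c \<in> U" "x \<in> c" by blast
      then obtain y where y: "y \<in> carrier G" "c = y <# H"
        using U by (auto simp: LCOSETS_def)
      then have "x <# H = c" using c l_repr_independence[of x y H] H by simp
      then show "x <# H \<in> U" using c by simp
    qed
    moreover have "\<Union>U \<subseteq> carrier G" using U un by blast
    ultimately show ?thesis by (auto simp: topspace_eq_carrier)
  qed
  show ?thesis
    unfolding continuous_map_def
  proof (intro conjI allI impI)
    show "(\<lambda>g. g <# H) \<in> topspace T \<rightarrow> topspace (coset_topology G T H)"
      by (auto simp: topspace_coset_topology[OF H] topspace_eq_carrier LCOSETS_def)
    show "openin T {x \<in> topspace T. x <# H \<in> U}" if "openin (coset_topology G T H) U" for U
      using that pre openin_coset_topology[OF H] by simp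
  qed
qed

text \<open>The union of the image is the saturation of \<open>U\<close> under \<open>H\<close>,
  which is a union of right translates of \<open>U\<close> and hence open.\<close>

lemma openin_coset_projection_image:
  assumes H: "subgroup H G" and U: "openin T U"
  shows "openin (coset_topology G T H) ((\<lambda>g. g <# H) ` U)"
proof -
  have "\<Union>((\<lambda>g. g <# H) ` U) = (\<Union>h\<in>H. U #> h)"
    by (auto simp: l_coset_def r_coset_def)
  moreover have "openin T (\<Union>h\<in>H. U #> h)"
    using openin_r_coset[OF U] subgroup.subset[OF H] by blast
  moreover have "(\<lambda>g. g <# H) ` U \<subseteq> lcosets H"
    using openin_subset_carrier[OF U] by (auto simp: LCOSETS_def)
  ultimately show ?thesis
    using openin_coset_topology[OF H] by simp
qed

end

section \<open>Borel sets and basic properties of Haar measures\<close>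

lemma space_borel_on [simp]: "space (borel_on T) = topspace T"
  unfolding borel_on_def using openin_subset by (subst space_measure_of) blast+

lemma sets_borel_on_openin: "openin T U \<Longrightarrow> U \<in> sets (borel_on T)"
  unfolding borel_on_def using openin_subset by (subst sets_measure_of) blast+

lemma sets_borel_on_closedin:
  assumes "closedin T C"
  shows "C \<in> sets (borel_on T)"
proof -
  have "topspace T - (topspace T - C) \<in> sets (borel_on T)"
    using assms sets_borel_on_openin[of T "topspace T - C"]
      sets.compl_sets[of "topspace T - C" "borel_on T"]
    by (simp add: closedin_def)
  then show ?thesis
    using closedin_subset[OF assms] by (simp add: Diff_Diff_Int inf.absorb2)
qed

lemma haar_measureD:
  assumes "haar_measure G T \<mu>"
  shows haar_measure_sets: "sets \<mu> = sets (borel_on T)"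
    and haar_measure_pos: "\<And>U. openin T U \<Longrightarrow> U \<noteq> {} \<Longrightarrow> 0 < emeasure \<mu> U"
    and haar_measure_translate:
      "\<And>g A. g \<in> carrier G \<Longrightarrow> A \<in> sets \<mu> \<Longrightarrow> emeasure \<mu> (g <#\<^bsub>G\<^esub> A) = emeasure \<mu> A"
  using assms by (simp_all add: haar_measure_def)

section \<open>Counting elements of a discrete subgroup by packing translates into
  \<open>H\<close>\<close>

context topological_group
begin

text \<open>Packing bound: by left invariance all the translates have the measure of
  \<open>W\<close>, and being disjoint they add up inside \<open>B\<close>.\<close>

lemma card_disjoint_translates_le:
  assumes H: "subgroup H G"
    and haar: "haar_measure (G\<lparr>carrier := H\<rparr>) (subtopology T H) m"
    and W: "openin (subtopology T H) W"
    and F: "finite F" "\<And>i. i \<in> F \<Longrightarrow> c i \<in> H"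
    and disj: "disjoint_family_on (\<lambda>i. c i <# W) F"
    and B: "B \<in> sets m" "\<And>i. i \<in> F \<Longrightarrow> c i <# W \<subseteq> B"
  shows "of_nat (card F) * emeasure m W \<le> emeasure m B"
proof -
  have sets: "U \<in> sets m" if "openin (subtopology T H) U" for U
    using that haar_measure_sets[OF haar] sets_borel_on_openin by simp
  \<comment> \<open>Left translates depend only on the multiplication, so those formed in
    \<open>G\<close> and in its restriction to \<open>H\<close> are the same sets.\<close>
  have tr: "emeasure m (h <# W) = emeasure m W" if "h \<in> H" for h
    using haar_measure_translate[OF haar, of h W] that sets[OF W] by (simp add: l_coset_def)
  have "of_nat (card F) * emeasure m W = (\<Sum>i\<in>F. emeasure m (c i <# W))"
    using F tr by simp
  also have "\<dots> = emeasure m (\<Union>i\<in>F. c i <# W)"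
    using F disj sets openin_subgroup_l_coset[OF H W] by (intro sum_emeasure) auto
  also have "\<dots> \<le> emeasure m B"
    using B by (intro emeasure_mono) blast+
  finally show ?thesis .
qed

text \<open>The number \<open>w\<close> is fixed before \<open>S\<close>, \<open>B\<close> and
  \<open>M\<close>, so one constant serves every gauge radius later. Distinct elements of
  \<open>S\<close> give disjoint translates of \<open>V \<inter> H\<close> because a common point
  would put their quotient into \<open>N \<inter> \<Gamma>\<close>.\<close>

lemma translates_by_discrete_subgroup_count:
  assumes H: "subgroup H G"
    and haar: "haar_measure (G\<lparr>carrier := H\<rparr>) (subtopology T H) m"
    and \<Gamma>: "subgroup \<Gamma> G" and N: "N \<inter> \<Gamma> = {\<one>}"
    and g: "g \<in> carrier G"
    and A: "openin T A" and V: "openin T V" "\<one> \<in> V"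
    and AV: "\<forall>u\<in>A. \<forall>v\<in>A. \<forall>w\<in>V. \<forall>w'\<in>V. (u \<otimes> w) \<otimes> inv (v \<otimes> w') \<in> N"
  obtains w :: real where "w > 0"
    "\<And>S B M. \<lbrakk>S \<subseteq> \<Gamma>; B \<in> sets m; 0 \<le> M; emeasure m B \<le> ennreal M;
       \<And>\<gamma>. \<gamma> \<in> S \<Longrightarrow> \<exists>k\<in>A. inv g \<otimes> \<gamma> \<otimes> k \<in> H \<and> (inv g \<otimes> \<gamma> \<otimes> k) <# (V \<inter> H) \<subseteq> B\<rbrakk>
     \<Longrightarrow> finite S \<and> real (card S) * w \<le> M"
proof -
  define W where "W = V \<inter> H"
  have W: "openin (subtopology T H) W" "W \<noteq> {}"
    using V subgroup.one_closed[OF H] by (auto simp: W_def openin_subtopology_Int)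
  have "emeasure m W > 0"
    using haar_measure_pos[OF haar] W by simp
  \<comment> \<open>\<open>emeasure m W\<close> may be infinite, so a positive real lower bound
    takes its place in the count.\<close>
  then have "\<exists>w>0. ennreal w \<le> emeasure m W"
    by (cases "emeasure m W") (auto intro: exI[of _ 1])
  then obtain w :: real where w: "w > 0" "ennreal w \<le> emeasure m W"
    by blast
  have fin: "real (card F) * w \<le> M"
    if F: "finite F" "F \<subseteq> \<Gamma>" and B: "B \<in> sets m" and M: "0 \<le> M" "emeasure m B \<le> ennreal M"
      and k: "\<forall>\<gamma>\<in>F. \<exists>k\<in>A. inv g \<otimes> \<gamma> \<otimes> k \<in> H \<and> (inv g \<otimes> \<gamma> \<otimes> k) <# W \<subseteq> B"
    for F B M
  proof -
    obtain k where k: "\<And>\<gamma>. \<gamma> \<in> F \<Longrightarrow> k \<gamma> \<in> A \<and> inv g \<otimes> \<gamma> \<otimes> k \<gamma> \<in> H \<and> (inv g \<otimes> \<gamma> \<otimes> k \<gamma>) <# W \<subseteq> B"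
      using bchoice[OF k[unfolded Bex_def]] by blast
    have "disjoint_family_on (\<lambda>\<gamma>. (inv g \<otimes> \<gamma> \<otimes> k \<gamma>) <# W) F"
      unfolding disjoint_family_on_def
    proof (intro ballI impI, rule ccontr)
      fix \<gamma> \<delta> assume \<gamma>: "\<gamma> \<in> F" and \<delta>: "\<delta> \<in> F" and "\<gamma> \<noteq> \<delta>"
        and "((inv g \<otimes> \<gamma> \<otimes> k \<gamma>) <# W) \<inter> ((inv g \<otimes> \<delta> \<otimes> k \<delta>) <# W) \<noteq> {}"
      then obtain v v' where v: "v \<in> W" "v' \<in> W"
        and eq: "inv g \<otimes> \<gamma> \<otimes> k \<gamma> \<otimes> v = inv g \<otimes> \<delta> \<otimes> k \<delta> \<otimes> v'"
        unfolding l_coset_def by blast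
      have c: "\<gamma> \<in> carrier G" "\<delta> \<in> carrier G" "k \<gamma> \<in> carrier G" "k \<delta> \<in> carrier G"
        "v \<in> carrier G" "v' \<in> carrier G"
        using F \<gamma> \<delta> k v subgroup.subset[OF \<Gamma>] subgroup.subset[OF H] openin_subset_carrier[OF A]
        by (auto simp: W_def)
      \<comment> \<open>Cancelling \<open>inv g\<close> and solving the equation for
        \<open>inv \<gamma> \<otimes> \<delta>\<close> exhibits this element of \<Gamma> in the form
        covered by \<open>AV\<close>.\<close>
      have "inv g \<otimes> (\<gamma> \<otimes> (k \<gamma> \<otimes> v)) = inv g \<otimes> (\<delta> \<otimes> (k \<delta> \<otimes> v'))"
        using eq c g by (simp add: m_assoc)
      then have "\<gamma> \<otimes> (k \<gamma> \<otimes> v) = \<delta> \<otimes> (k \<delta> \<otimes> v')"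
        using c g by simp
      then have "k \<gamma> \<otimes> v = inv \<gamma> \<otimes> (\<delta> \<otimes> (k \<delta> \<otimes> v'))"
        using c by (metis inv_closed l_inv l_one m_assoc m_closed)
      then have "inv \<gamma> \<otimes> \<delta> = (k \<gamma> \<otimes> v) \<otimes> inv (k \<delta> \<otimes> v')"
        using c by (simp add: m_assoc)
      moreover have "(k \<gamma> \<otimes> v) \<otimes> inv (k \<delta> \<otimes> v') \<in> N"
        using AV k \<gamma> \<delta> v unfolding W_def by blast
      moreover have "inv \<gamma> \<otimes> \<delta> \<in> \<Gamma>"
        using F \<gamma> \<delta> subgroup.m_closed[OF \<Gamma>] subgroup.m_inv_closed[OF \<Gamma>] by blast
      ultimately have "inv \<gamma> \<otimes> \<delta> = \<one>"
        using N by auto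
      then have "\<gamma> = \<delta>"
        using c by (metis inv_closed inv_inv inv_equality)
      then show False
        using \<open>\<gamma> \<noteq> \<delta>\<close> by simp
    qed
    then have "of_nat (card F) * emeasure m W \<le> emeasure m B"
      using k F B by (intro card_disjoint_translates_le[OF H haar W(1)]) blast+
    moreover have "ennreal (real (card F) * w) \<le> of_nat (card F) * emeasure m W"
      using w by (simp add: ennreal_mult' ennreal_of_nat_eq_real_of_nat mult_left_mono)
    ultimately have "ennreal (real (card F) * w) \<le> ennreal M"
      using M by (meson order_trans)
    then show ?thesis
      using M by simp
  qed
  show thesis
  proof (rule that[OF w(1)])
    fix S B M
    assume *: "S \<subseteq> \<Gamma>" "B \<in> sets m" "0 \<le> M" "emeasure m B \<le> ennreal M"
      "\<And>\<gamma>. \<gamma> \<in> S \<Longrightarrow> \<exists>k\<in>A. inv g \<otimes> \<gamma> \<otimes> k \<in> H \<and> (inv g \<otimes> \<gamma> \<otimes> k) <# (V \<inter> H) \<subseteq> B"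
    have F: "real (card F) * w \<le> M" if "finite F" "F \<subseteq> S" for F
      using that * by (intro fin[of F B M]) (auto simp: W_def)
    \<comment> \<open>A bound shared by all finite subsets forces \<open>S\<close> to be finite.
      This has to come first, since \<open>card\<close> of an infinite set is 0.\<close>
    have "card F \<le> nat \<lfloor>M / w\<rfloor>" if "finite F" "F \<subseteq> S" for F
      using F[OF that] w(1) by (intro le_nat_floor) (simp add: pos_le_divide_eq)
    then have "finite S"
      by (rule finite_if_finite_subsets_card_bdd[THEN conjunct1]) auto
    then show "finite S \<and> real (card S) * w \<le> M"
      using F by blast
  qed
qed

text \<open>The codomain \<open>{0..}\<close> makes \<open>D\<close> nonnegative, so the ball is the
  preimage of the compact interval \<open>{0..t}\<close>, empty for negative
  \<open>t\<close>.\<close>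

lemma gauge_ball_compact:
  assumes "proper_map T (top_of_set {0..}) D" 
  shows "compactin T (gauge_ball G D t)"
proof -
  have "gauge_ball G D t = {x \<in> topspace T. D x \<in> {0..t}}"
    using assms proper_map_imp_subset_topspace[OF assms]
    by (auto simp: gauge_ball_def topspace_eq_carrier)
  moreover have "compactin (top_of_set {0..}) {0..t}"
    by (simp add: compactin_subtopology)
  ultimately show ?thesis
    using compactin_proper_map_preimage[OF assms, of "{0..t}"] by simp
qed

lemma gauge_ball_open:
  fixes D :: "'a \<Rightarrow> real"
  assumes "continuous_map T (top_of_set {0..}) D" 
  shows "openin T {g \<in> carrier G. D g < t}"
proof -
  have "continuous_map T euclidean D"
    using assms continuous_map_into_fulltopology by blast
  from openin_continuous_map_preimage[OF this, of "{..<t}"] show ?thesis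
    by (simp add: topspace_eq_carrier)
qed

lemma gauge_ball_closed:
  assumes "continuous_map T (top_of_set {0..}) D" 
  shows "closedin T (gauge_ball G D t)"
proof -
  have "continuous_map T euclidean D"
    using assms continuous_map_into_fulltopology by blast
  from closedin_continuous_map_preimage[OF this, of "{..t}"] show ?thesis
    by (simp add: topspace_eq_carrier gauge_ball_def)
qed

lemma discrete_subgroup_nbhd_one:
  assumes "subgroup \<Gamma> G" "subtopology T \<Gamma> = discrete_topology \<Gamma>"
  obtains N where "openin T N" "N \<inter> \<Gamma> = {\<one>}"
proof -
  have "openin (subtopology T \<Gamma>) {\<one>}"
    using assms subgroup.one_closed by (simp add: openin_discrete_topology)
  then show thesis
    using that by (metis openin_subtopology)
qed

text \<open>\<open>C\<close> and \<open>b\<close> depend on \<open>g\<close> and \<open>n\<close>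
  but not on \<open>t\<close> or \<open>M\<close>. The bound \<open>M\<close> is left open so that
  the growth assumption on \<open>H\<close> can supply it for each \<open>t\<close>.\<close>

lemma lattice_points_count:
  assumes H: "subgroup H G"
    and haar: "haar_measure (G\<lparr>carrier := H\<rparr>) (subtopology T H) m"
    and \<Gamma>: "subgroup \<Gamma> G" "subtopology T \<Gamma> = discrete_topology \<Gamma>"
    and D: "continuous_map T (top_of_set {0..}) D" "proper_map T (top_of_set {0..}) D"
    and A2: "assumption2 G T D"
    and g: "g \<in> carrier G"
  obtains C b :: real where "C \<ge> 0"
    "\<forall>t M. 0 \<le> M \<and> emeasure m (gauge_ball G D (t + b) \<inter> H) \<le> ennreal M \<longrightarrow>
      finite {\<gamma>\<in>\<Gamma>. D \<gamma> \<le> t \<and> (\<exists>k\<in>gauge_ball G D n. inv g \<otimes> \<gamma> \<otimes> k \<in> H)} \<and>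
      real (card {\<gamma>\<in>\<Gamma>. D \<gamma> \<le> t \<and> (\<exists>k\<in>gauge_ball G D n. inv g \<otimes> \<gamma> \<otimes> k \<in> H)}) \<le> C * M"
proof -
  define K where "K = gauge_ball G D n"
  \<comment> \<open>This radius makes \<Omega> contain \<open>K\<close>, \<open>inv g\<close> and an
    open neighbourhood of \<open>\<one>\<close>, so one application of \<open>assumption2\<close>
    serves all the factors below.\<close>
  define s where "s = Max {n, D \<one> + 1, D (inv g)}"
  define \<Omega> where "\<Omega> = gauge_ball G D s"
  have K: "compactin T K" "K \<subseteq> carrier G" and "compactin T \<Omega>"
    using gauge_ball_compact[OF D(2)] by (auto simp: K_def \<Omega>_def gauge_ball_def)
  then obtain b where b: "\<And>u v h. u \<in> \<Omega> \<Longrightarrow> v \<in> \<Omega> \<Longrightarrow> h \<in> carrier G \<Longrightarrow> D (u \<otimes> h \<otimes> v) \<le> D h + b"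
    using A2 unfolding assumption2_def by blast
  have \<Omega>: "K \<subseteq> \<Omega>" "inv g \<in> \<Omega>" "\<one> \<in> \<Omega>" and V\<Omega>: "{h \<in> carrier G. D h < D \<one> + 1} \<subseteq> \<Omega>"
    using g by (auto simp: K_def \<Omega>_def gauge_ball_def s_def)
  \<comment> \<open>One \<open>b\<close> is spent on the factors \<open>inv g\<close> and
    \<open>k\<close> around \<gamma>, the other on \<open>v\<close>; this is the source of the shift
    \<open>2 * b\<close>.\<close>
  have Dh: "D (inv g \<otimes> \<gamma> \<otimes> k \<otimes> v) \<le> D \<gamma> + 2 * b"
    if "\<gamma> \<in> carrier G" "k \<in> K" "v \<in> \<Omega>" for \<gamma> k v
  proof -
    have k: "k \<in> carrier G" "k \<in> \<Omega>" using that K \<Omega> by auto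
    have "D (\<one> \<otimes> (inv g \<otimes> \<gamma> \<otimes> k) \<otimes> v) \<le> D (inv g \<otimes> \<gamma> \<otimes> k) + b"
      using b[OF \<Omega>(3) that(3)] k g that(1) by simp
    also have "D (inv g \<otimes> \<gamma> \<otimes> k) \<le> D \<gamma> + b"
      using b[OF \<Omega>(2) k(2) that(1)] .
    finally show ?thesis using k g that(1) by simp
  qed
  obtain N where N: "openin T N" "N \<inter> \<Gamma> = {\<one>}"
    using discrete_subgroup_nbhd_one[OF \<Gamma>] .
  define good where "good A V \<longleftrightarrow> openin T A \<and> openin T V \<and> \<one> \<in> V \<and> V \<subseteq> \<Omega> \<and>
     (\<forall>u\<in>A. \<forall>v\<in>A. \<forall>w\<in>V. \<forall>w'\<in>V. (u \<otimes> w) \<otimes> inv (v \<otimes> w') \<in> N)" for A V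
  have "\<exists>A V. k \<in> A \<and> good A V" if "k \<in> K" for k
  proof -
    have 1: "\<one> \<in> N" "k \<in> carrier G" using N that K(2) by auto
    obtain A V where AV: "openin T A" "k \<in> A" "openin T V" "\<one> \<in> V"
      "\<forall>u\<in>A. \<forall>v\<in>A. \<forall>w\<in>V. \<forall>w'\<in>V. (u \<otimes> w) \<otimes> inv (v \<otimes> w') \<in> N"
      using nbhd_mult_inv_subset[OF 1(2) N(1) 1(1)] .
    \<comment> \<open>Cutting \<open>V\<close> down to a gauge neighbourhood of
      \<open>\<one>\<close> inside \<Omega> keeps the translates of \<open>V \<inter> H\<close>
      within a gauge ball of controlled radius.\<close>
    then have "good A (V \<inter> {h \<in> carrier G. D h < D \<one> + 1})"
      using gauge_ball_open[OF D(1)] V\<Omega> by (auto simp: good_def)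
    then show ?thesis using AV(2) by blast
  qed
  then have "K \<subseteq> \<Union>{A. \<exists>V. good A V}" by blast
  moreover have "\<forall>A\<in>{A. \<exists>V. good A V}. openin T A" by (auto simp: good_def)
  ultimately obtain \<F> where \<F>: "finite \<F>" "\<F> \<subseteq> {A. \<exists>V. good A V}" "K \<subseteq> \<Union>\<F>"
    using K(1) unfolding compactin_def by meson
  \<comment> \<open>The elements to be counted are sorted by the piece \<open>A\<close> of the cover
    that contains the witness \<open>k\<close>; one element may occur for several pieces, which is
    harmless for an upper bound.\<close>
  define S where "S t A = {\<gamma>\<in>\<Gamma>. D \<gamma> \<le> t \<and> (\<exists>k\<in>K \<inter> A. inv g \<otimes> \<gamma> \<otimes> k \<in> H)}" for t A
  have "\<exists>w>0. \<forall>t M. 0 \<le> M \<and> emeasure m (gauge_ball G D (t + 2 * b) \<inter> H) \<le> ennreal M \<longrightarrow>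
      finite (S t A) \<and> real (card (S t A)) * w \<le> M" if A: "A \<in> \<F>" for A
  proof -
    obtain V where V: "good A V" using A \<F> by blast
    obtain w :: real where w: "w > 0"
    "\<And>S B M. \<lbrakk>S \<subseteq> \<Gamma>; B \<in> sets m; 0 \<le> M; emeasure m B \<le> ennreal M;
       \<And>\<gamma>. \<gamma> \<in> S \<Longrightarrow> \<exists>k\<in>A. inv g \<otimes> \<gamma> \<otimes> k \<in> H \<and> (inv g \<otimes> \<gamma> \<otimes> k) <# (V \<inter> H) \<subseteq> B\<rbrakk>
     \<Longrightarrow> finite S \<and> real (card S) * w \<le> M"
      by (rule translates_by_discrete_subgroup_count[OF H haar \<Gamma>(1) N(2) g, of A V])
        (use V in \<open>auto simp: good_def\<close>)
    have "finite (S t A) \<and> real (card (S t A)) * w \<le> M"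
      if M: "0 \<le> M" "emeasure m (gauge_ball G D (t + 2 * b) \<inter> H) \<le> ennreal M" for t M
    proof (rule w(2)[OF _ _ M])
      show "S t A \<subseteq> \<Gamma>" by (auto simp: S_def)
      have "closedin (subtopology T H) (gauge_ball G D (t + 2 * b) \<inter> H)"
        using gauge_ball_closed[OF D(1)] by (auto simp: closedin_subtopology)
      then show "gauge_ball G D (t + 2 * b) \<inter> H \<in> sets m"
        using haar_measure_sets[OF haar] sets_borel_on_closedin by simp
      fix \<gamma> assume "\<gamma> \<in> S t A"
      then obtain k where k: "\<gamma> \<in> \<Gamma>" "D \<gamma> \<le> t" "k \<in> K" "k \<in> A" "inv g \<otimes> \<gamma> \<otimes> k \<in> H"
        unfolding S_def by blast
      have "inv g \<otimes> \<gamma> \<otimes> k \<otimes> v \<in> gauge_ball G D (t + 2 * b) \<inter> H" if "v \<in> V" "v \<in> H" for v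
      proof -
        have "v \<in> \<Omega>" using that V unfolding good_def by blast
        moreover have "\<gamma> \<in> carrier G" using k subgroup.subset[OF \<Gamma>(1)] by blast
        ultimately have "D (inv g \<otimes> \<gamma> \<otimes> k \<otimes> v) \<le> t + 2 * b"
          using Dh[of \<gamma> k v] k by simp
        moreover have "inv g \<otimes> \<gamma> \<otimes> k \<otimes> v \<in> H"
          using k that subgroup.m_closed[OF H] by blast
        ultimately show ?thesis
          using subgroup.subset[OF H] unfolding gauge_ball_def by blast
      qed
      then have "(inv g \<otimes> \<gamma> \<otimes> k) <# (V \<inter> H) \<subseteq> gauge_ball G D (t + 2 * b) \<inter> H"
        unfolding l_coset_def by blast
      then show "\<exists>k\<in>A. inv g \<otimes> \<gamma> \<otimes> k \<in> H \<and>
          (inv g \<otimes> \<gamma> \<otimes> k) <# (V \<inter> H) \<subseteq> gauge_ball G D (t + 2 * b) \<inter> H"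
        using k by blast
    qed
    then show ?thesis using w(1) by blast
  qed
  then obtain w where w: "\<And>A. A \<in> \<F> \<Longrightarrow> w A > 0 \<and> (\<forall>t M. 0 \<le> M \<and>
      emeasure m (gauge_ball G D (t + 2 * b) \<inter> H) \<le> ennreal M \<longrightarrow>
      finite (S t A) \<and> real (card (S t A)) * w A \<le> M)"
    using bchoice[of \<F>] by (metis (no_types, lifting))
  show thesis
  proof (rule that)
    \<comment> \<open>The piece \<open>A\<close> contributes at most \<open>M / w A\<close>
      elements, so the constant is the sum of the reciprocals.\<close>
    show "0 \<le> (\<Sum>A\<in>\<F>. 1 / w A)"
      using w by (intro sum_nonneg) (simp add: less_imp_le)
    have "finite {\<gamma>\<in>\<Gamma>. D \<gamma> \<le> t \<and> (\<exists>k\<in>gauge_ball G D n. inv g \<otimes> \<gamma> \<otimes> k \<in> H)} \<and>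
      real (card {\<gamma>\<in>\<Gamma>. D \<gamma> \<le> t \<and> (\<exists>k\<in>gauge_ball G D n. inv g \<otimes> \<gamma> \<otimes> k \<in> H)}) \<le> (\<Sum>A\<in>\<F>. 1 / w A) * M"
      if M: "0 \<le> M" "emeasure m (gauge_ball G D (t + 2 * b) \<inter> H) \<le> ennreal M" for t M
    proof -
    have eq: "{\<gamma>\<in>\<Gamma>. D \<gamma> \<le> t \<and> (\<exists>k\<in>gauge_ball G D n. inv g \<otimes> \<gamma> \<otimes> k \<in> H)} = (\<Union>A\<in>\<F>. S t A)"
      using \<F>(3) unfolding K_def[symmetric] S_def by blast
    have "real (card (\<Union>A\<in>\<F>. S t A)) \<le> (\<Sum>A\<in>\<F>. real (card (S t A)))"
      using card_UN_le[OF \<F>(1), of "S t"] by (simp flip: of_nat_sum)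
    also have "\<dots> \<le> (\<Sum>A\<in>\<F>. 1 / w A * M)"
      using w M by (intro sum_mono) (simp add: field_simps)
    finally have "real (card (\<Union>A\<in>\<F>. S t A)) \<le> (\<Sum>A\<in>\<F>. 1 / w A) * M"
      by (simp add: sum_distrib_right)
    then show ?thesis
      unfolding eq using \<F>(1) w M by blast
    qed
    then show "\<forall>t M. 0 \<le> M \<and> emeasure m (gauge_ball G D (t + 2 * b) \<inter> H) \<le> ennreal M \<longrightarrow>
      finite {\<gamma>\<in>\<Gamma>. D \<gamma> \<le> t \<and> (\<exists>k\<in>gauge_ball G D n. inv g \<otimes> \<gamma> \<otimes> k \<in> H)} \<and>
      real (card {\<gamma>\<in>\<Gamma>. D \<gamma> \<le> t \<and> (\<exists>k\<in>gauge_ball G D n. inv g \<otimes> \<gamma> \<otimes> k \<in> H)}) \<le> (\<Sum>A\<in>\<F>. 1 / w A) * M"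
      by blast
  qed
qed

end

section \<open>Null sets of well approximable points\<close>

text \<open>The intersection lies in every single \<open>E j\<close> of the tail, so its measure is
  below each \<open>e j\<close>, and \<open>e\<close> tending to zero is enough. This is what
  approximability at all small scales provides.\<close>

lemma null_sets_INT_tail:
  fixes E :: "nat \<Rightarrow> 'a set" and e :: "nat \<Rightarrow> real"
  assumes "\<And>j. E j \<in> sets M" "\<And>j. j \<ge> m \<Longrightarrow> emeasure M (E j) \<le> ennreal (e j)" "e \<longlonglongrightarrow> 0"
  shows "(\<Inter>j\<in>{m..}. E j) \<in> null_sets M"
proof -
  have meas: "(\<Inter>j\<in>{m..}. E j) \<in> sets M"
    using assms(1) by (intro sets.countable_INT') auto
  have "emeasure M (\<Inter>j\<in>{m..}. E j) \<le> ennreal (e j)" if "j \<ge> m" for j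
    by (rule order_trans[OF emeasure_mono assms(2)[OF that]]) (use assms(1) that in auto)
  moreover have "(\<lambda>j. ennreal (e j)) \<longlonglongrightarrow> 0"
    using tendsto_ennrealI[OF assms(3)] by simp
  ultimately have "emeasure M (\<Inter>j\<in>{m..}. E j) \<le> 0"
    by (intro LIMSEQ_le_const) auto
  then show ?thesis
    using meas by auto
qed

lemma emeasure_UN_le_card_mult:
  assumes "finite I" "\<And>i. i \<in> I \<Longrightarrow> A i \<in> sets M" "\<And>i. i \<in> I \<Longrightarrow> emeasure M (A i) \<le> ennreal c"
    and "real (card I) \<le> n" "0 \<le> c"
  shows "emeasure M (\<Union>i\<in>I. A i) \<le> ennreal (n * c)"
proof -
  have "emeasure M (\<Union>i\<in>I. A i) \<le> (\<Sum>i\<in>I. emeasure M (A i))"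
    using assms by (intro emeasure_subadditive_finite) auto
  also have "\<dots> \<le> of_nat (card I) * ennreal c"
    using assms by (intro sum_bounded_above) auto
  also have "\<dots> = ennreal (real (card I) * c)"
    using assms by (simp add: ennreal_mult' ennreal_of_nat_eq_real_of_nat)
  also have "\<dots> \<le> ennreal (n * c)"
    using assms by (intro ennreal_leI mult_right_mono) auto
  finally show ?thesis .
qed

context topological_group
begin

text \<open>Translates the geometric condition on the orbit point into membership in
  \<open>H\<close>, the form in which elements are counted.\<close>

lemma lcoset_translate_eq_iff:
  assumes H: "subgroup H G" and c: "\<gamma> \<in> carrier G" "g \<in> carrier G" "k \<in> carrier G"
  shows "inv \<gamma> <# (g <# H) = k <# H \<longleftrightarrow> inv g \<otimes> \<gamma> \<otimes> k \<in> H"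
proof -
  define p where "p = inv \<gamma> \<otimes> g"
  have p: "p \<in> carrier G" "inv p \<otimes> k = inv g \<otimes> \<gamma> \<otimes> k" and px: "inv \<gamma> <# (g <# H) = p <# H"
    using c lcos_m_assoc[OF subgroup.subset[OF H]] by (auto simp: p_def inv_mult_group m_assoc)
  have "p <# H = k <# H \<longleftrightarrow> inv p \<otimes> k \<in> H"
  proof
    assume "p <# H = k <# H"
    then have "k \<in> p <# H"
      using lcos_self[OF c(3) H] by simp
    then obtain h where "h \<in> H" "k = p \<otimes> h"
      unfolding l_coset_def by blast
    then show "inv p \<otimes> k \<in> H"
      using p(1) subgroup.mem_carrier[OF H] by (simp add: m_assoc[symmetric])
  next
    assume "inv p \<otimes> k \<in> H"
    moreover have "k = p \<otimes> (inv p \<otimes> k)"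
      using p(1) c by (simp add: m_assoc[symmetric])
    ultimately have "k \<in> p <# H"
      unfolding l_coset_def by blast
    then show "p <# H = k <# H"
      using l_repr_independence p H by blast
  qed
  then show ?thesis
    unfolding px p(2) .
qed

text \<open>\<open>Z\<close> is chosen before \<open>g\<^sub>0\<close> and
  \<open>\<epsilon>\<^sub>0\<close>. The bound \<open>n\<close> confines the relevant orbit points
  to the image of a compact gauge ball, where both the count and the ball estimates have uniform
  constants.\<close>

lemma well_approximable_null:
  assumes H: "subgroup H G"
    and haar: "haar_measure (G\<lparr>carrier := H\<rparr>) (subtopology T H) m"
    and mX: "sets m\<^sub>X = sets (borel_on (coset_topology G T H))"
    and metric: "Metric_space (lcosets H) d"
    and mtop: "Metric_space.mtopology (lcosets H) d = coset_topology G T H"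
    and \<Gamma>: "subgroup \<Gamma> G" "subtopology T \<Gamma> = discrete_topology \<Gamma>"
    and D: "continuous_map T (top_of_set {0..}) D" "proper_map T (top_of_set {0..}) D"
    and A2: "assumption2 G T D"
    and A3: "assumption3 G T H m D a' a"
    and A4: "assumption4 G T H m\<^sub>X d \<delta>' \<delta>"
    and g: "g \<in> carrier G"
    and q: "0 < q" "q * a < \<delta>'"
  obtains Z where "Z \<in> null_sets m\<^sub>X"
    "\<forall>g\<^sub>0\<in>carrier G. D g\<^sub>0 < n \<longrightarrow> (\<exists>\<epsilon>\<^sub>0>0. \<forall>\<epsilon>. 0 < \<epsilon> \<and> \<epsilon> < \<epsilon>\<^sub>0 \<longrightarrow>
       (\<exists>\<gamma>\<in>\<Gamma>. d (inv \<gamma> <# (g <# H)) (g\<^sub>0 <# H) \<le> \<epsilon> \<and> exp (D \<gamma>) \<le> \<epsilon> powr (- q))) \<longrightarrow>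
       g\<^sub>0 <# H \<in> Z"
proof -
  interpret X: Metric_space "lcosets H" d by (rule metric)
  \<comment> \<open>Half of the gap \<open>\<delta>' - q * a\<close> is spent on the two losses
    \<eta>, leaving the exponent \<open>r\<close> equal to minus the other half.\<close>
  define \<eta> where "\<eta> = (\<delta>' - q * a) / (2 * (1 + q))"
  define r where "r = q * (a + \<eta>) - (\<delta>' - \<eta>)"
  have "\<eta> * (1 + q) = (\<delta>' - q * a) / 2"
    using q by (simp add: \<eta>_def field_simps)
  then have r: "r < 0"
    using q(2) by (simp add: r_def algebra_simps)
  have \<eta>: "\<eta> > 0"
    using q by (simp add: \<eta>_def)
  define x where "x = g <# H"
  define P where "P t = {\<gamma>\<in>\<Gamma>. D \<gamma> \<le> t \<and> (\<exists>k\<in>gauge_ball G D n. inv g \<otimes> \<gamma> \<otimes> k \<in> H)}" for t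
  obtain C b :: real where C: "C \<ge> 0" and count: "\<forall>t M. 0 \<le> M \<and>
      emeasure m (gauge_ball G D (t + b) \<inter> H) \<le> ennreal M \<longrightarrow>
      finite (P t) \<and> real (card (P t)) \<le> C * M"
    unfolding P_def using lattice_points_count[OF H haar \<Gamma> D A2 g, of n] .
  obtain C2 t\<^sub>\<eta> where C2: "C2 \<ge> 1"
    "\<And>t. t \<ge> t\<^sub>\<eta> \<Longrightarrow> emeasure m (gauge_ball G D t \<inter> H) \<le> ennreal (C2 * exp (t * (a + \<eta>)))"
    using A3[unfolded assumption3_def, THEN conjunct2, THEN conjunct2, THEN conjunct1,
        rule_format, OF \<eta>] by blast
  define S where "S = (\<lambda>k. k <# H) ` gauge_ball G D n"
  have S: "compactin (coset_topology G T H) S"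
    unfolding S_def
    using image_compactin[OF gauge_ball_compact[OF D(2)] continuous_map_coset_projection[OF H]] .
  then obtain C3 \<epsilon>\<^sub>1 where C3: "C3 \<ge> 1" "\<epsilon>\<^sub>1 > 0"
    "\<And>y \<epsilon>. y \<in> S \<Longrightarrow> 0 < \<epsilon> \<Longrightarrow> \<epsilon> < \<epsilon>\<^sub>1 \<Longrightarrow>
      emeasure m\<^sub>X (X.mball y \<epsilon>) \<le> ennreal (C3 * \<epsilon> powr (\<delta>' - \<eta>))"
    using A4[unfolded assumption4_def, THEN conjunct2, THEN conjunct2, rule_format, OF S \<eta>]
    by blast
  \<comment> \<open>The scales are dyadic, and \<open>t j\<close> is chosen so that
    \<open>exp (t j)\<close> equals \<open>\<epsilon> j powr (- q)\<close>.\<close>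
  define t where "t j = q * (real j * ln 2)" for j :: nat
  define \<epsilon> :: "nat \<Rightarrow> real" where "\<epsilon> j = (1/2) ^ j" for j
  have \<epsilon>: "\<epsilon> j > 0" "\<epsilon> j \<le> 1" "ln (\<epsilon> j) = - (real j * ln 2)" for j
    by (auto simp: \<epsilon>_def power_le_one ln_realpow ln_div)
  have \<epsilon>_lim: "\<epsilon> \<longlonglongrightarrow> 0"
    unfolding \<epsilon>_def by (rule LIMSEQ_realpow_zero) auto
  \<comment> \<open>Doubling the radius lets the open balls contain points at distance exactly
    \<open>\<epsilon> j\<close> from the centre.\<close>
  define E where "E j = (\<Union>\<gamma>\<in>P (t j). X.mball (inv \<gamma> <# x) (2 * \<epsilon> j))" for j
  define e where "e j = C * (C2 * exp ((t j + b) * (a + \<eta>))) * (C3 * (2 * \<epsilon> j) powr (\<delta>' - \<eta>))" for j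
  have open_sets: "U \<in> sets m\<^sub>X" if "openin (coset_topology G T H) U" for U
    using that mX sets_borel_on_openin by simp
  have ball_open: "openin (coset_topology G T H) (X.mball y s)" for y s
    using X.openin_mball mtop by simp
  have E_sets: "E j \<in> sets m\<^sub>X" for j
    unfolding E_def using ball_open by (intro open_sets openin_Union) auto
  have "filterlim t at_top sequentially"
    unfolding t_def using q(1)
    by (intro filterlim_tendsto_pos_mult_at_top[OF tendsto_const]
        filterlim_at_top_mult_tendsto_pos[OF tendsto_const] filterlim_real_sequentially) auto
  then have "\<forall>\<^sub>F j in sequentially. t j \<ge> t\<^sub>\<eta> - b"
    by (simp add: filterlim_at_top)
  moreover have "\<forall>\<^sub>F j in sequentially. \<epsilon> j < \<epsilon>\<^sub>1 / 2"
    using order_tendstoD(2)[OF \<epsilon>_lim, of "\<epsilon>\<^sub>1 / 2"] C3(2) by simp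
  ultimately have "\<forall>\<^sub>F j in sequentially. t j \<ge> t\<^sub>\<eta> - b \<and> \<epsilon> j < \<epsilon>\<^sub>1 / 2"
    by (rule eventually_conj)
  \<comment> \<open>From \<open>j\<^sub>0\<close> on, the growth bound applies at
    \<open>t j + b\<close> and the ball bound at radius \<open>2 * \<epsilon> j\<close>.\<close>
  then obtain j\<^sub>0 where j0: "\<And>j. j \<ge> j\<^sub>0 \<Longrightarrow> t j \<ge> t\<^sub>\<eta> - b \<and> \<epsilon> j < \<epsilon>\<^sub>1 / 2"
    unfolding eventually_sequentially by blast
  have E_le: "emeasure m\<^sub>X (E j) \<le> ennreal (e j)" if j: "j \<ge> j\<^sub>0" for j
    unfolding E_def e_def
  proof (rule emeasure_UN_le_card_mult)
    have "finite (P (t j)) \<and> real (card (P (t j))) \<le> C * (C2 * exp ((t j + b) * (a + \<eta>)))"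
      using C2(1) C2(2)[of "t j + b"] j0[OF j]
      by (intro count[rule_format]) auto
    then show "finite (P (t j))" "real (card (P (t j))) \<le> C * (C2 * exp ((t j + b) * (a + \<eta>)))"
      by auto
    show "X.mball (inv \<gamma> <# x) (2 * \<epsilon> j) \<in> sets m\<^sub>X" for \<gamma>
      using ball_open open_sets by blast
    show "0 \<le> C3 * (2 * \<epsilon> j) powr (\<delta>' - \<eta>)"
      using C3 by simp
    fix \<gamma> assume "\<gamma> \<in> P (t j)"
    then obtain k where k: "\<gamma> \<in> \<Gamma>" "k \<in> gauge_ball G D n" "inv g \<otimes> \<gamma> \<otimes> k \<in> H"
      unfolding P_def by blast
    \<comment> \<open>The centres vary with \<open>j\<close> but remain in the compact set
      \<open>S\<close>, so the same \<open>C3\<close> bounds all the balls.\<close>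
    then have "inv \<gamma> <# x = k <# H"
      using lcoset_translate_eq_iff[OF H, of \<gamma> g k] subgroup.mem_carrier[OF \<Gamma>(1)] g
      by (auto simp: x_def gauge_ball_def)
    then have "inv \<gamma> <# x \<in> S"
      using k(2) by (simp add: S_def)
    then show "emeasure m\<^sub>X (X.mball (inv \<gamma> <# x) (2 * \<epsilon> j)) \<le> ennreal (C3 * (2 * \<epsilon> j) powr (\<delta>' - \<eta>))"
      using \<epsilon>(1)[of j] j0[OF j] by (intro C3(3)) auto
  qed
  \<comment> \<open>Up to a constant factor the bound is a geometric sequence with ratio 2 to the
    power \<open>r\<close>, which is less than 1.\<close>
  have e_eq: "e j = C * C2 * C3 * exp (b * (a + \<eta>)) * 2 powr (\<delta>' - \<eta>) * exp (ln 2 * r) ^ j" for j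
  proof -
    have 1: "(2 * \<epsilon> j) powr (\<delta>' - \<eta>) = 2 powr (\<delta>' - \<eta>) * exp ((\<delta>' - \<eta>) * ln (\<epsilon> j))"
      using \<epsilon>(1)[of j] by (simp add: powr_def ln_mult distrib_left exp_add)
    have 2: "exp ((t j + b) * (a + \<eta>)) * exp ((\<delta>' - \<eta>) * ln (\<epsilon> j)) =
        exp (b * (a + \<eta>)) * exp (real j * (ln 2 * r))"
      unfolding exp_add[symmetric] by (simp add: \<epsilon>(3) t_def r_def algebra_simps)
    have "e j = C * C2 * C3 * 2 powr (\<delta>' - \<eta>) *
        (exp ((t j + b) * (a + \<eta>)) * exp ((\<delta>' - \<eta>) * ln (\<epsilon> j)))"
      unfolding e_def 1 by (simp only: mult_ac)
    then show ?thesis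
      unfolding 2 exp_of_nat_mult by (simp only: mult_ac)
  qed
  have "exp (ln 2 * r) < 1"
    using r by (simp add: mult_pos_neg)
  then have "(\<lambda>j. exp (ln 2 * r) ^ j) \<longlonglongrightarrow> 0"
    by (intro LIMSEQ_realpow_zero) auto
  then have e_lim: "e \<longlonglongrightarrow> 0"
    unfolding e_eq[abs_def] by (rule tendsto_mult_right_zero)
  \<comment> \<open>The points that lie in \<open>E j\<close> for all large \<open>j\<close>.
    Starting at \<open>max j\<^sub>0 l\<close> makes the measure bounds valid on each tail.\<close>
  define Z where "Z = (\<Union>l. \<Inter>j\<in>{max j\<^sub>0 l..}. E j)"
  have "Z \<in> null_sets m\<^sub>X"
    unfolding Z_def using E_sets E_le e_lim by (intro null_sets_UN null_sets_INT_tail) auto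
  moreover have "g\<^sub>0 <# H \<in> Z"
    if g0: "g\<^sub>0 \<in> carrier G" "D g\<^sub>0 < n" and e0: "0 < \<epsilon>\<^sub>0"
      and approx: "\<forall>\<epsilon>. 0 < \<epsilon> \<and> \<epsilon> < \<epsilon>\<^sub>0 \<longrightarrow>
        (\<exists>\<gamma>\<in>\<Gamma>. d (inv \<gamma> <# (g <# H)) (g\<^sub>0 <# H) \<le> \<epsilon> \<and> exp (D \<gamma>) \<le> \<epsilon> powr (- q))"
    for g\<^sub>0 \<epsilon>\<^sub>0
  proof -
    define x0 where "x0 = g\<^sub>0 <# H"
    \<comment> \<open>The strict inequality makes \<open>U\<close> open, so orbit points close
      enough to \<open>x0\<close> have a representative in the gauge ball and their \<gamma> is
      counted in \<open>P\<close>.\<close>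
    define U where "U = (\<lambda>k. k <# H) ` {k \<in> carrier G. D k < n}"
    have "openin X.mtopology U"
      unfolding mtop U_def by (rule openin_coset_projection_image[OF H gauge_ball_open[OF D(1)]])
    moreover have "x0 \<in> U"
      using g0 by (auto simp: x0_def U_def)
    ultimately obtain s where s: "s > 0" "X.mball x0 s \<subseteq> U"
      unfolding X.openin_mtopology by blast
    have "\<forall>\<^sub>F j in sequentially. \<epsilon> j < min \<epsilon>\<^sub>0 s"
      using order_tendstoD(2)[OF \<epsilon>_lim, of "min \<epsilon>\<^sub>0 s"] e0 s(1) by simp
    then obtain l where l: "\<And>j. j \<ge> l \<Longrightarrow> \<epsilon> j < \<epsilon>\<^sub>0 \<and> \<epsilon> j < s"
      unfolding eventually_sequentially by auto
    have "x0 \<in> E j" if j: "j \<ge> l" for j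
    proof -
      obtain \<gamma> where \<gamma>: "\<gamma> \<in> \<Gamma>" "d (inv \<gamma> <# x) x0 \<le> \<epsilon> j" "exp (D \<gamma>) \<le> \<epsilon> j powr (- q)"
        using approx[rule_format, of "\<epsilon> j"] \<epsilon>(1)[of j] l[OF j] unfolding x_def x0_def by blast
      have \<gamma>c: "\<gamma> \<in> carrier G"
        using \<gamma>(1) subgroup.mem_carrier[OF \<Gamma>(1)] by blast
      have "inv \<gamma> <# x = (inv \<gamma> \<otimes> g) <# H"
        unfolding x_def using lcos_m_assoc[OF subgroup.subset[OF H]] \<gamma>c g by simp
      then have mem: "inv \<gamma> <# x \<in> lcosets H" "x0 \<in> lcosets H"
        using \<gamma>c g g0 by (auto simp: LCOSETS_def x0_def)
      have "inv \<gamma> <# x \<in> X.mball x0 s"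
        using \<gamma>(2) mem l[OF j] X.commute[of x0 "inv \<gamma> <# x"] by (simp add: X.in_mball)
      then obtain k where k: "k \<in> carrier G" "D k < n" "inv \<gamma> <# x = k <# H"
        using s(2) unfolding U_def by blast
      then have "inv g \<otimes> \<gamma> \<otimes> k \<in> H"
        using lcoset_translate_eq_iff[OF H \<gamma>c g k(1)] by (simp add: x_def)
      moreover have "D \<gamma> \<le> t j"
      proof -
        have "\<epsilon> j powr (- q) = exp (t j)"
          using \<epsilon>(1)[of j] \<epsilon>(3)[of j] by (simp add: powr_def t_def)
        then show ?thesis using \<gamma>(3) by simp
      qed
      ultimately have "\<gamma> \<in> P (t j)"
        using \<gamma>(1) k unfolding P_def gauge_ball_def by auto
      moreover have "x0 \<in> X.mball (inv \<gamma> <# x) (2 * \<epsilon> j)"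
        using \<gamma>(2) mem \<epsilon>(1)[of j] by (simp add: X.in_mball)
      ultimately show ?thesis
        unfolding E_def by blast
    qed
    then have "x0 \<in> (\<Inter>j\<in>{max j\<^sub>0 l..}. E j)"
      by simp
    then show ?thesis
      unfolding Z_def x0_def[symmetric] by blast
  qed
  ultimately show thesis
    by (intro that) blast+
qed

end

section \<open>Assembling countably many null sets\<close>

theorem theorem3p1:
  fixes G :: "('g, 'm) monoid_scheme"
    and T :: "'g topology"
    and H \<Gamma> :: "'g set"
    and m\<^sub>G m\<^sub>H :: "'g measure"
    and m\<^sub>X :: "'g set measure"
    and dist\<^sub>X :: "'g set \<Rightarrow> 'g set \<Rightarrow> real"
    and D :: "'g \<Rightarrow> real"
    and a' a d' d :: real
  assumes "lcsc_group G T"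
    and "subgroup H G" and "closedin T H"
    and "unimodular (G\<lparr>carrier := H\<rparr>) (subtopology T H)"
    and "haar_measure G T m\<^sub>G"
    and "haar_measure (G\<lparr>carrier := H\<rparr>) (subtopology T H) m\<^sub>H"
    and "sets m\<^sub>X = sets (borel_on (coset_topology G T H))"
    and "translation_invariant G m\<^sub>X"
    and "weil_formula G m\<^sub>G m\<^sub>H m\<^sub>X"
    and "Metric_space (lcosets\<^bsub>G\<^esub> H) dist\<^sub>X"
    and "Metric_space.mtopology (lcosets\<^bsub>G\<^esub> H) dist\<^sub>X = coset_topology G T H"
    and "continuous_map T (top_of_set {0..}) D"
    and "proper_map T (top_of_set {0..}) D"
    and "lattice_in G T \<Gamma>"
    and "ergodic_action G \<Gamma> m\<^sub>X"
    and "assumption1 G T H dist\<^sub>X"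
    and "assumption2 G T D"
    and "assumption3 G T H m\<^sub>H D a' a"
    and "assumption4 G T H m\<^sub>X dist\<^sub>X d' d"
  shows "\<forall>x \<in> lcosets\<^bsub>G\<^esub> H.
           coset_topology G T H closure_of {\<gamma> <#\<^bsub>G\<^esub> x |\<gamma>. \<gamma> \<in> \<Gamma>} = lcosets\<^bsub>G\<^esub> H \<longrightarrow>
           (AE x\<^sub>0 in m\<^sub>X. ereal (d' / a) \<le> approx_exponent G D dist\<^sub>X \<Gamma> x x\<^sub>0)"
proof (intro ballI impI)
  interpret topological_group G T
    using assms(1) by (simp add: lcsc_group_def)
  note H = assms(2)
  have \<Gamma>: "subgroup \<Gamma> G" "subtopology T \<Gamma> = discrete_topology \<Gamma>"
    using assms(14) by (simp_all add: lattice_in_def)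
  have a: "0 < a" "0 < d'"
    using assms(18,19) by (auto simp: assumption3_def assumption4_def)
  fix x assume "x \<in> lcosets\<^bsub>G\<^esub> H"
  then obtain g where g: "g \<in> carrier G" "x = g <#\<^bsub>G\<^esub> H"
    by (auto simp: LCOSETS_def)
  \<comment> \<open>Rational exponents and integer gauge bounds keep the union of the exceptional
    sets countable.\<close>
  define Q where "Q = {q\<in>\<rat>. 0 < q \<and> q < d' / a}"
  have "\<exists>Z. Z \<in> null_sets m\<^sub>X \<and> (\<forall>g\<^sub>0\<in>carrier G. D g\<^sub>0 < n \<longrightarrow> (\<exists>\<epsilon>\<^sub>0>0. \<forall>\<epsilon>. 0 < \<epsilon> \<and> \<epsilon> < \<epsilon>\<^sub>0 \<longrightarrow>
       (\<exists>\<gamma>\<in>\<Gamma>. dist\<^sub>X (inv\<^bsub>G\<^esub> \<gamma> <#\<^bsub>G\<^esub> x) (g\<^sub>0 <#\<^bsub>G\<^esub> H) \<le> \<epsilon> \<and> exp (D \<gamma>) \<le> \<epsilon> powr (- q))) \<longrightarrow>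
       g\<^sub>0 <#\<^bsub>G\<^esub> H \<in> Z)" if "q \<in> Q" for q :: real and n :: real
  proof -
    have q: "0 < q" "q * a < d'"
      using that a by (auto simp: Q_def pos_less_divide_eq)
    show ?thesis
      using well_approximable_null[OF H assms(6,7,10,11) \<Gamma> assms(12,13,17,18,19) g(1) q, of n]
      unfolding g(2) by metis
  qed
  then obtain Z where Z: "\<And>q n. q \<in> Q \<Longrightarrow> Z q n \<in> null_sets m\<^sub>X"
    "\<And>q n g\<^sub>0 \<epsilon>\<^sub>0. \<lbrakk>q \<in> Q; g\<^sub>0 \<in> carrier G; D g\<^sub>0 < n; 0 < \<epsilon>\<^sub>0; \<forall>\<epsilon>. 0 < \<epsilon> \<and> \<epsilon> < \<epsilon>\<^sub>0 \<longrightarrow>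
       (\<exists>\<gamma>\<in>\<Gamma>. dist\<^sub>X (inv\<^bsub>G\<^esub> \<gamma> <#\<^bsub>G\<^esub> x) (g\<^sub>0 <#\<^bsub>G\<^esub> H) \<le> \<epsilon> \<and> exp (D \<gamma>) \<le> \<epsilon> powr (- q))\<rbrakk> \<Longrightarrow>
       g\<^sub>0 <#\<^bsub>G\<^esub> H \<in> Z q n"
    by metis
  have "countable (Q \<times> (UNIV :: nat set))"
    by (intro countable_SIGMA countable_subset[OF _ countable_rat]) (auto simp: Q_def)
  then have null: "(\<Union>(q, n) \<in> Q \<times> (UNIV :: nat set). Z q (real n)) \<in> null_sets m\<^sub>X"
    using Z(1) by (intro null_sets_UN') auto
  show "AE x\<^sub>0 in m\<^sub>X. ereal (d' / a) \<le> approx_exponent G D dist\<^sub>X \<Gamma> x x\<^sub>0"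
  proof (rule AE_I'[OF null], rule subsetI)
    fix x\<^sub>0 assume x0: "x\<^sub>0 \<in> {x\<^sub>0 \<in> space m\<^sub>X. \<not> ereal (d' / a) \<le> approx_exponent G D dist\<^sub>X \<Gamma> x x\<^sub>0}"
    have "space m\<^sub>X = lcosets\<^bsub>G\<^esub> H"
      using sets_eq_imp_space_eq[OF assms(7)] topspace_coset_topology[OF H] by simp
    then obtain g\<^sub>0 where g0: "g\<^sub>0 \<in> carrier G" "x\<^sub>0 = g\<^sub>0 <#\<^bsub>G\<^esub> H"
      using x0 by (auto simp: LCOSETS_def)
    have "approx_exponent G D dist\<^sub>X \<Gamma> x x\<^sub>0 < ereal (d' / a)"
      using x0 by (simp add: not_le)
    \<comment> \<open>An infimum below \<open>d' / a\<close> is witnessed by an admissible exponent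
      below \<open>d' / a\<close>, which is then raised to a rational \<open>q\<close>.\<close>
    then obtain \<zeta> \<epsilon>\<^sub>0 where \<zeta>: "\<zeta> > 0" "\<zeta> < d' / a" and e0: "\<epsilon>\<^sub>0 > 0"
      and approx: "\<forall>\<epsilon>. 0 < \<epsilon> \<and> \<epsilon> < \<epsilon>\<^sub>0 \<longrightarrow>
          (\<exists>\<gamma>\<in>\<Gamma>. dist\<^sub>X (inv\<^bsub>G\<^esub> \<gamma> <#\<^bsub>G\<^esub> x) x\<^sub>0 \<le> \<epsilon> \<and> exp (D \<gamma>) \<le> \<epsilon> powr (- \<zeta>))"
      unfolding approx_exponent_def Inf_less_iff by auto
    obtain q where q: "q \<in> \<rat>" "\<zeta> < q" "q < d' / a"
      using Rats_dense_in_real[OF \<zeta>(2)] by blast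
    then have qQ: "q \<in> Q"
      using \<zeta> by (simp add: Q_def)
    obtain n :: nat where n: "D g\<^sub>0 < real n"
      using reals_Archimedean2 by blast
    have "\<exists>\<gamma>\<in>\<Gamma>. dist\<^sub>X (inv\<^bsub>G\<^esub> \<gamma> <#\<^bsub>G\<^esub> x) (g\<^sub>0 <#\<^bsub>G\<^esub> H) \<le> \<epsilon> \<and> exp (D \<gamma>) \<le> \<epsilon> powr (- q)"
      if \<epsilon>: "0 < \<epsilon>" "\<epsilon> < min \<epsilon>\<^sub>0 1" for \<epsilon>
    proof -
      \<comment> \<open>Raising the exponent weakens the condition only for \<epsilon> at most 1;
        this is why the threshold becomes \<open>min \<epsilon>\<^sub>0 1\<close>.\<close>
      have "\<epsilon> powr (- \<zeta>) \<le> \<epsilon> powr (- q)"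
        using \<epsilon> q by (intro powr_mono') auto
      moreover have "\<exists>\<gamma>\<in>\<Gamma>. dist\<^sub>X (inv\<^bsub>G\<^esub> \<gamma> <#\<^bsub>G\<^esub> x) (g\<^sub>0 <#\<^bsub>G\<^esub> H) \<le> \<epsilon> \<and> exp (D \<gamma>) \<le> \<epsilon> powr (- \<zeta>)"
        using approx \<epsilon> g0(2) by simp
      ultimately show ?thesis
        by (meson order_trans)
    qed
    then have "x\<^sub>0 \<in> Z q (real n)"
      unfolding g0(2) using e0 by (intro Z(2)[OF qQ g0(1) n, of "min \<epsilon>\<^sub>0 1"]) auto
    then show "x\<^sub>0 \<in> (\<Union>(q, n) \<in> Q \<times> (UNIV :: nat set). Z q (real n))"
      using qQ by blast
  qed
qed

end
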